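(* There exist a finitely generated group $G$ (with word length $|\cdot|$ associated with a finite symmetric generating set), a weakly mixing unitary representation $\pi\colon G\to\mathcal U(\mathcal H)$ on a Hilbert space $\mathcal H$, and a $1$-cocycle $b\colon G\to\mathcal H$ for $\pi$ such that $$\limsup_{|g|\to\infty}\frac{\lVert b(g)\rVert}{|g|}=1.$$
   Context: $G$ is a discrete group with a fixed finite symmetric generating set, and $|g|$ is the associated word length; the limsup is $\lim_{N\to\infty}\sup\{\lVert b(g)\rVert/|g| : g\in G,\ |g|\ge N\}$. $\mathcal U(\mathcal H)$ is the unitary group of $\mathcal H$. A unitary representation is weakly mixing if it has no non-zero finite-dimensional subrepresentations. A $1$-cocycle for $\pi$ is a map $b\colon G\to\mathcal H$ with $b(gh)=b(g)+\pi(g)b(h)$ for all $g,h\in G$. *)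

theory Defs
  imports
    "HOL-Algebra.Module"
    "HOL-Algebra.Bij"
    "HOL-Algebra.Generated_Groups"
    "HOL-Analysis.Abstract_Metric_Spaces"
    "HOL-Library.Extended_Real"
begin

section \<open>Word length\<close>

definition finite_symmetric_generating_set :: "('g, 'm) monoid_scheme \<Rightarrow> 'g set \<Rightarrow> bool" where
  "finite_symmetric_generating_set G S \<longleftrightarrow>
     finite S \<and> S \<subseteq> carrier G \<and> (\<forall>s\<in>S. inv\<^bsub>G\<^esub> s \<in> S) \<and> generate G S = carrier G"

definition word_length :: "('g, 'm) monoid_scheme \<Rightarrow> 'g set \<Rightarrow> 'g \<Rightarrow> nat" where
  "word_length G S g =
     (LEAST n. \<exists>ws. set ws \<subseteq> S \<and> length ws = n \<and> foldr (\<otimes>\<^bsub>G\<^esub>) ws \<one>\<^bsub>G\<^esub> = g)"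


section \<open>Complex Hilbert spaces\<close>

text \<open>Complex vector spaces are modules over the field of complex numbers. As with every
  \<^const>\<open>carrier\<close>-based module, the ring multiplication and unit of the record play no role.
  The operations are part of the structure and are not tied to those of the element type. Every
  separable Hilbert space is isomorphic to one with elements of type
  \<^typ>\<open>nat \<Rightarrow> complex\<close>, and cocycles of countable groups take values in separable
  subrepresentations.\<close>

definition complex_ring :: "complex ring" where
  "complex_ring = \<lparr>carrier = UNIV, mult = (*), one = 1, zero = 0, add = (+)\<rparr>"

record 'v hilbert = "(complex, 'v) module" +
  iprod :: "'v \<Rightarrow> 'v \<Rightarrow> complex"

definition hnorm :: "('v, 'm) hilbert_scheme \<Rightarrow> 'v \<Rightarrow> real" where
  "hnorm H x = sqrt (Re (iprod H x x))"

text \<open>The value outside the carrier is fixed because \<^locale>\<open>Metric_space\<close> requires symmetry and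
  nonnegativity of the distance for all elements of the type.\<close>

definition hdist :: "('v, 'm) hilbert_scheme \<Rightarrow> 'v \<Rightarrow> 'v \<Rightarrow> real" where
  "hdist H x y = (if x \<in> carrier H \<and> y \<in> carrier H then hnorm H (x \<ominus>\<^bsub>H\<^esub> y) else 0)"

text \<open>The inner product is linear in the first argument.\<close>

locale complex_hilbert_space = Module.module complex_ring H for H (structure) +
  assumes iprod_add_left:
      "\<lbrakk>x \<in> carrier H; y \<in> carrier H; z \<in> carrier H\<rbrakk>
        \<Longrightarrow> iprod H (x \<oplus> y) z = iprod H x z + iprod H y z"
    and iprod_smult_left:
      "\<lbrakk>x \<in> carrier H; y \<in> carrier H\<rbrakk> \<Longrightarrow> iprod H (c \<odot> x) y = c * iprod H x y"
    and iprod_commute: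
      "\<lbrakk>x \<in> carrier H; y \<in> carrier H\<rbrakk> \<Longrightarrow> iprod H y x = cnj (iprod H x y)"
    and iprod_pos:
      "\<lbrakk>x \<in> carrier H; x \<noteq> \<zero>\<rbrakk> \<Longrightarrow> 0 < Re (iprod H x x)"
    and complete: "Metric_space.mcomplete (carrier H) (hdist H)"


section \<open>Unitary representations and cocycles\<close>

definition unitary_operators :: "('v, 'm) hilbert_scheme \<Rightarrow> ('v \<Rightarrow> 'v) set" where
  "unitary_operators H =
     {U \<in> Bij (carrier H).
        (\<forall>x\<in>carrier H. \<forall>y\<in>carrier H. U (x \<oplus>\<^bsub>H\<^esub> y) = U x \<oplus>\<^bsub>H\<^esub> U y) \<and>
        (\<forall>c. \<forall>x\<in>carrier H. U (c \<odot>\<^bsub>H\<^esub> x) = c \<odot>\<^bsub>H\<^esub> U x) \<and>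
        (\<forall>x\<in>carrier H. \<forall>y\<in>carrier H. iprod H (U x) (U y) = iprod H x y)}"

definition unitary_group :: "('v, 'm) hilbert_scheme \<Rightarrow> ('v \<Rightarrow> 'v) monoid" where
  "unitary_group H = BijGroup (carrier H) \<lparr>carrier := unitary_operators H\<rparr>"

definition unitary_representation ::
  "('g, 'm) monoid_scheme \<Rightarrow> ('v, 'n) hilbert_scheme \<Rightarrow> ('g \<Rightarrow> 'v \<Rightarrow> 'v) \<Rightarrow> bool" where
  "unitary_representation G H \<pi> \<longleftrightarrow>
     group G \<and> complex_hilbert_space H \<and> \<pi> \<in> hom G (unitary_group H)"

definition subrepresentation ::
  "('g, 'm) monoid_scheme \<Rightarrow> ('v, 'n) hilbert_scheme \<Rightarrow> ('g \<Rightarrow> 'v \<Rightarrow> 'v) \<Rightarrow> 'v set \<Rightarrow> bool" where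
  "subrepresentation G H \<pi> W \<longleftrightarrow>
     submodule W complex_ring H \<and>
     closedin (Metric_space.mtopology (carrier H) (hdist H)) W \<and>
     (\<forall>g\<in>carrier G. \<forall>w\<in>W. \<pi> g w \<in> W)"

definition finite_dimensional :: "('v, 'n) hilbert_scheme \<Rightarrow> 'v set \<Rightarrow> bool" where
  "finite_dimensional H W \<longleftrightarrow>
     (\<exists>B. finite B \<and> B \<subseteq> W \<and>
        (\<forall>w\<in>W. \<exists>c. w = (\<Oplus>\<^bsub>H\<^esub>v\<in>B. c v \<odot>\<^bsub>H\<^esub> v)))"

definition weakly_mixing ::
  "('g, 'm) monoid_scheme \<Rightarrow> ('v, 'n) hilbert_scheme \<Rightarrow> ('g \<Rightarrow> 'v \<Rightarrow> 'v) \<Rightarrow> bool" where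
  "weakly_mixing G H \<pi> \<longleftrightarrow>
     \<not> (\<exists>W. subrepresentation G H \<pi> W \<and> finite_dimensional H W \<and> W \<noteq> {\<zero>\<^bsub>H\<^esub>})"

definition cocycle ::
  "('g, 'm) monoid_scheme \<Rightarrow> ('v, 'n) hilbert_scheme \<Rightarrow> ('g \<Rightarrow> 'v \<Rightarrow> 'v) \<Rightarrow> ('g \<Rightarrow> 'v) \<Rightarrow> bool"
  where
  "cocycle G H \<pi> b \<longleftrightarrow>
     b \<in> carrier G \<rightarrow> carrier H \<and>
     (\<forall>g\<in>carrier G. \<forall>h\<in>carrier G. b (g \<otimes>\<^bsub>G\<^esub> h) = b g \<oplus>\<^bsub>H\<^esub> \<pi> g (b h))"

end

theory Submission
  imports Defs "HOL-Algebra.Weak_Morphisms" "HOL-Analysis.Infinite_Sum" "HOL-Analysis.L2_Norm"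
    "HOL-Library.Function_Algebras"
begin

text \<open>Let \<open>G\<close> be the group of affine isometries of \<open>\<ell>\<^sup>2(\<nat>)\<close> generated by the translation by
  \<open>\<delta>\<^sub>0\<close>, the sign flip of coordinate 0, and two permutations of \<open>\<nat>\<close> generating a transitive
  group; let \<open>\<pi>\<close> be the linear part and \<open>b\<close> the translation part. All generators have
  \<open>\<parallel>b\<parallel> \<le> 1\<close>, so \<open>\<parallel>b(g)\<parallel> \<le> |g|\<close>. As \<open>\<pi>\<close> is trivial on translations, the
  \<open>n\<close>-th power of the first generator has \<open>\<parallel>b\<parallel> = n\<close> and hence word length exactly \<open>n\<close>.
  Finally, a nonzero invariant subspace contains a vector nonzero at 0, so by the sign flip it
  contains \<open>\<delta>\<^sub>0\<close>, and by transitivity every \<open>\<delta>\<^sub>n\<close>; thus \<open>\<pi>\<close> is weakly mixing.\<close>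

section \<open>The Hilbert space of square-summable functions\<close>

definition square_summable :: "('i \<Rightarrow> complex) \<Rightarrow> bool" where
  "square_summable x \<longleftrightarrow> (\<lambda>i. (cmod (x i))\<^sup>2) summable_on UNIV"

definition l2_norm :: "('i \<Rightarrow> complex) \<Rightarrow> real" where
  "l2_norm x = sqrt (\<Sum>\<^sub>\<infinity>i. (cmod (x i))\<^sup>2)"

lemma l2_norm_nonneg [simp]: "0 \<le> l2_norm x"
  by (simp add: l2_norm_def infsum_nonneg)

lemma L2_set_le_l2_norm:
  assumes "square_summable x" "finite F"
  shows "L2_set (\<lambda>i. cmod (x i)) F \<le> l2_norm x"
  using assms unfolding L2_set_def l2_norm_def square_summable_def
  by (intro real_sqrt_le_mono finite_sum_le_infsum) auto

text \<open>Bounds on all finite sections bound the partial sums of squares by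
  \<open>C\<^sup>2\<close>, so the nonnegative series converges below \<open>C\<^sup>2\<close>. This
  transfers inequalities and limits for \<open>L2_set\<close> to infinite sums.\<close>

lemma
  assumes "\<And>F. finite F \<Longrightarrow> L2_set (\<lambda>i. cmod (x i)) F \<le> C"
  shows square_summableI: "square_summable x" and l2_norm_leI: "l2_norm x \<le> C"
proof -
  have C: "(\<Sum>i\<in>F. (cmod (x i))\<^sup>2) \<le> C\<^sup>2" if "finite F" for F
    using assms[OF that] unfolding L2_set_def
    by (rule sqrt_le_D)
  show "square_summable x"
    unfolding square_summable_def using C
    by (intro nonneg_bdd_above_summable_on bdd_aboveI[of _ "C\<^sup>2"]) auto
  then have "(\<Sum>\<^sub>\<infinity>i. (cmod (x i))\<^sup>2) \<le> C\<^sup>2"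
    unfolding square_summable_def using C by (intro infsum_le_finite_sums) auto
  \<comment> \<open>The empty section supplies the sign of \<open>C\<close> needed to take the
    square root.\<close>
  moreover have "0 \<le> C" using assms[of "{}"] by simp
  ultimately show "l2_norm x \<le> C" unfolding l2_norm_def by (simp add: real_le_lsqrt infsum_nonneg)
qed

lemma L2_set_add_le:
  assumes "square_summable x" "square_summable y" "finite F"
  shows "L2_set (\<lambda>i. cmod (x i + y i)) F \<le> l2_norm x + l2_norm y"
proof -
  have "L2_set (\<lambda>i. cmod (x i + y i)) F \<le> L2_set (\<lambda>i. cmod (x i) + cmod (y i)) F"
    by (intro L2_set_mono norm_triangle_ineq) auto
  also have "\<dots> \<le> L2_set (\<lambda>i. cmod (x i)) F + L2_set (\<lambda>i. cmod (y i)) F"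
    by (rule L2_set_triangle_ineq)
  also have "\<dots> \<le> l2_norm x + l2_norm y"
    using assms by (intro add_mono L2_set_le_l2_norm)
  finally show ?thesis .
qed

lemma square_summable_add:
  "square_summable x \<Longrightarrow> square_summable y \<Longrightarrow> square_summable (x + y)"
  by (rule square_summableI[of _ "l2_norm x + l2_norm y"]) (simp add: L2_set_add_le)

lemma l2_norm_triangle:
  "square_summable x \<Longrightarrow> square_summable y \<Longrightarrow> l2_norm (x + y) \<le> l2_norm x + l2_norm y"
  by (rule l2_norm_leI) (simp add: L2_set_add_le)

lemma square_summable_scale: "square_summable x \<Longrightarrow> square_summable (\<lambda>i. c * x i)"
  unfolding square_summable_def norm_mult power_mult_distrib by (rule summable_on_cmult_right)

lemma square_summable_uminus: "square_summable x \<Longrightarrow> square_summable (- x)"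
  by (simp add: square_summable_def)

lemma square_summable_diff:
  "square_summable x \<Longrightarrow> square_summable y \<Longrightarrow> square_summable (x - y)"
  using square_summable_add[of x "- y"] square_summable_uminus[of y] by simp

lemma square_summable_zero: "square_summable 0"
  by (simp add: square_summable_def)

lemma cmod_le_l2_norm: "square_summable x \<Longrightarrow> cmod (x i) \<le> l2_norm x"
  using L2_set_le_l2_norm[of x "{i}"] by simp

lemma l2_norm_eq_0_iff: "square_summable x \<Longrightarrow> l2_norm x = 0 \<longleftrightarrow> x = 0"
  using cmod_le_l2_norm[of x] by (auto simp: fun_eq_iff) (simp add: l2_norm_def)

lemma l2_norm_diff_commute: "l2_norm (x - y) = l2_norm (y - x)"
  by (simp add: l2_norm_def norm_minus_commute)

text \<open>Comparison with the sum of the squares, via \<open>2ab \<le> a^2 + b^2\<close>.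
  Additivity of the inner product rests on this, since \<open>infsum\<close> is 0 on families that
  are not summable.\<close>

lemma product_summable:
  assumes "square_summable x" "square_summable y"
  shows "(\<lambda>i. x i * cnj (y i)) summable_on UNIV"
proof (rule abs_summable_summable, rule abs_summable_on_comparison_test)
  show "(\<lambda>i. (cmod (x i))\<^sup>2 + (cmod (y i))\<^sup>2) abs_summable_on UNIV"
    using assms by (simp add: square_summable_def summable_on_add)
  fix i
  have "2 * (cmod (x i) * cmod (y i)) \<le> (cmod (x i))\<^sup>2 + (cmod (y i))\<^sup>2"
    using sum_squares_bound[of "cmod (x i)" "cmod (y i)"] by (simp only: mult.assoc)
  moreover have "0 \<le> cmod (x i) * cmod (y i)" by simp
  ultimately have "cmod (x i) * cmod (y i) \<le> (cmod (x i))\<^sup>2 + (cmod (y i))\<^sup>2"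
    by linarith
  then show "norm (x i * cnj (y i)) \<le> norm ((cmod (x i))\<^sup>2 + (cmod (y i))\<^sup>2)"
    by (simp add: norm_mult)
qed

section \<open>The Hilbert space structure on square-summable functions\<close>

definition l2 :: "('i \<Rightarrow> complex) hilbert" where
  "l2 = \<lparr>carrier = Collect square_summable, monoid.mult = (*), one = 1, zero = 0, add = (+),
         smult = \<lambda>c x i. c * x i, iprod = \<lambda>x y. \<Sum>\<^sub>\<infinity>i. x i * cnj (y i)\<rparr>"

lemma l2_simps [simp]:
  "carrier l2 = Collect square_summable" "\<zero>\<^bsub>l2\<^esub> = 0" "x \<oplus>\<^bsub>l2\<^esub> y = x + y"
  "c \<odot>\<^bsub>l2\<^esub> x = (\<lambda>i. c * x i)" "iprod l2 x y = (\<Sum>\<^sub>\<infinity>i. x i * cnj (y i))"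
  by (simp_all add: l2_def)

lemma module_l2: "Module.module complex_ring l2"
proof (rule moduleI)
  show "cring complex_ring"
  proof (intro cringI abelian_groupI comm_monoidI)
    show "\<exists>y\<in>carrier complex_ring. y \<oplus>\<^bsub>complex_ring\<^esub> x = \<zero>\<^bsub>complex_ring\<^esub>" for x
      by (auto simp: complex_ring_def intro: exI[of _ "- x"])
  qed (auto simp: complex_ring_def algebra_simps)
  show "abelian_group l2"
  proof (rule abelian_groupI)
    show "\<exists>y\<in>carrier l2. y \<oplus>\<^bsub>l2\<^esub> x = \<zero>\<^bsub>l2\<^esub>" if "x \<in> carrier l2" for x
      using that by (intro bexI[of _ "- x"]) (auto simp: square_summable_uminus)
  qed (auto simp: square_summable_add square_summable_zero add_ac)
  show "\<one>\<^bsub>complex_ring\<^esub> \<odot>\<^bsub>l2\<^esub> x = x" for x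
    by (simp add: complex_ring_def)
qed (simp_all add: complex_ring_def square_summable_scale distrib_left distrib_right mult.assoc plus_fun_def)

interpretation l2: Module.module complex_ring l2
  by (rule module_l2)

lemma l2_uminus: "square_summable x \<Longrightarrow> \<ominus>\<^bsub>l2\<^esub> x = - x"
  by (rule l2.minus_equality) (auto simp: square_summable_uminus)

lemma hnorm_l2:
  assumes "square_summable x"
  shows "hnorm l2 x = l2_norm x"
proof -
  have "Re (iprod l2 x x) = (\<Sum>\<^sub>\<infinity>i. Re (x i * cnj (x i)))"
    using infsum_Re[OF product_summable[OF assms assms]] by simp
  also have "\<dots> = (\<Sum>\<^sub>\<infinity>i. (cmod (x i))\<^sup>2)"
    unfolding cmod_power2 by (simp add: power2_eq_square)
  finally show ?thesis by (simp add: hnorm_def l2_norm_def)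
qed

lemma hdist_l2: "square_summable x \<Longrightarrow> square_summable y \<Longrightarrow> hdist l2 x y = l2_norm (x - y)"
  by (simp add: hdist_def a_minus_def l2_uminus hnorm_l2 square_summable_diff)

lemma Metric_space_l2: "Metric_space (carrier l2) (hdist l2)"
proof
  show "0 \<le> hdist l2 x y" "hdist l2 x y = hdist l2 y x" for x y :: "'a \<Rightarrow> complex"
    using hdist_l2[of x y] hdist_l2[of y x] by (auto simp: hdist_def l2_norm_diff_commute)
  fix x y z :: "'a \<Rightarrow> complex"
  assume x: "x \<in> carrier l2" and y: "y \<in> carrier l2"
  then show "(hdist l2 x y = 0) = (x = y)"
    by (simp add: hdist_l2 l2_norm_eq_0_iff square_summable_diff)
  assume "z \<in> carrier l2"
  with x y show "hdist l2 x z \<le> hdist l2 x y + hdist l2 y z"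
    using l2_norm_triangle[of "x - y" "y - z"] by (simp add: hdist_l2 square_summable_diff)
qed

text \<open>Coordinates of a Cauchy sequence are Cauchy, which gives a pointwise limit
  \<open>y\<close>; the Cauchy estimate on finite sections survives the passage to \<open>y\<close>
  and yields convergence in norm.\<close>

lemma mcomplete_l2: "Metric_space.mcomplete (carrier l2) (hdist (l2 :: ('i \<Rightarrow> complex) hilbert))"
proof -
  interpret M: Metric_space "carrier l2" "hdist (l2 :: ('i \<Rightarrow> complex) hilbert)"
    by (rule Metric_space_l2)
  show ?thesis
    unfolding M.mcomplete_def
  proof (intro allI impI)
    fix X :: "nat \<Rightarrow> 'i \<Rightarrow> complex" assume X: "M.MCauchy X"
    then have "range X \<subseteq> carrier l2" unfolding M.MCauchy_def by blast
    then have sq [simp]: "square_summable (X k)" for k by auto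
    have cau: "\<exists>K. \<forall>k\<ge>K. \<forall>l\<ge>K. l2_norm (X k - X l) < \<epsilon>" if "\<epsilon> > 0" for \<epsilon>
    proof -
      have "\<exists>K. \<forall>k l. K \<le> k \<longrightarrow> K \<le> l \<longrightarrow> hdist l2 (X k) (X l) < \<epsilon>"
        using X that unfolding M.MCauchy_def by blast
      then show ?thesis by (simp add: hdist_l2)
    qed
    have "convergent (\<lambda>k. X k i)" for i
    proof (rule Cauchy_convergent, rule CauchyI)
      fix \<epsilon> :: real assume "\<epsilon> > 0"
      with cau obtain K where K: "\<forall>k\<ge>K. \<forall>l\<ge>K. l2_norm (X k - X l) < \<epsilon>" by blast
      have "norm (X k i - X l i) < \<epsilon>" if "k \<ge> K" "l \<ge> K" for k l
      proof -
        have "norm (X k i - X l i) \<le> l2_norm (X k - X l)"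
          using cmod_le_l2_norm[OF square_summable_diff[OF sq sq], of k l i] by simp
        also have "\<dots> < \<epsilon>" using K that by blast
        finally show ?thesis .
      qed
      then show "\<exists>K. \<forall>k\<ge>K. \<forall>l\<ge>K. norm (X k i - X l i) < \<epsilon>" by blast
    qed
    then obtain y where y: "\<And>i. (\<lambda>k. X k i) \<longlonglongrightarrow> y i"
      unfolding convergent_def by metis
    \<comment> \<open>Let \<open>l\<close> tend to infinity: over a finite \<open>F\<close>
      pointwise convergence suffices, and the resulting bound is uniform in
      \<open>F\<close>.\<close>
    have diff: "L2_set (\<lambda>i. cmod ((X k - y) i)) F \<le> \<epsilon>"
      if "\<forall>k\<ge>K. \<forall>l\<ge>K. l2_norm (X k - X l) < \<epsilon>" "k \<ge> K" "finite F" for K k \<epsilon> F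
    proof (rule tendsto_upperbound)
      show "(\<lambda>l. L2_set (\<lambda>i. cmod (X k i - X l i)) F) \<longlonglongrightarrow> L2_set (\<lambda>i. cmod ((X k - y) i)) F"
        unfolding L2_set_def minus_apply by (intro tendsto_intros y)
      show "\<forall>\<^sub>F l in sequentially. L2_set (\<lambda>i. cmod (X k i - X l i)) F \<le> \<epsilon>"
        using eventually_ge_at_top[of K]
      proof eventually_elim
        case (elim l)
        then have "l2_norm (X k - X l) < \<epsilon>" using that by blast
        then show ?case
          using L2_set_le_l2_norm[of "X k - X l" F] that(3) by (simp add: square_summable_diff)
      qed
    qed simp
    \<comment> \<open>\<open>y\<close> is the difference of \<open>X K\<close> and
      \<open>X K - y\<close>.\<close>
    have ysq: "square_summable y"
    proof -
      obtain K where "\<forall>k\<ge>K. \<forall>l\<ge>K. l2_norm (X k - X l) < 1" using cau[of 1] by auto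
      then have "square_summable (X K - y)" using diff[of K 1 K] by (blast intro: square_summableI)
      then show ?thesis using square_summable_diff[of "X K" "X K - y"] by simp
    qed
    have "\<exists>K. \<forall>k\<ge>K. hdist l2 (X k) y < \<epsilon>" if \<epsilon>: "\<epsilon> > 0" for \<epsilon>
    proof -
      \<comment> \<open>The limit preserves only a weak inequality; halving \<epsilon> makes it
        strict again.\<close>
      obtain K where K: "\<forall>k\<ge>K. \<forall>l\<ge>K. l2_norm (X k - X l) < \<epsilon> / 2" using cau[of "\<epsilon> / 2"] \<epsilon> by fastforce
      have "l2_norm (X k - y) < \<epsilon>" if "k \<ge> K" for k
        using l2_norm_leI[of "X k - y" "\<epsilon> / 2"] diff[OF K that] \<open>\<epsilon> > 0\<close> by fastforce
      then show ?thesis using ysq by (auto simp: hdist_l2)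
    qed
    then show "\<exists>y. limitin M.mtopology X y sequentially"
      unfolding M.limit_metric_sequentially using ysq by auto
  qed
qed

lemma complex_hilbert_space_l2: "complex_hilbert_space l2"
proof (intro complex_hilbert_space.intro module_l2 complex_hilbert_space_axioms.intro mcomplete_l2)
  fix x y z :: "'a \<Rightarrow> complex" and c
  assume x: "x \<in> carrier l2"
  show "0 < Re (iprod l2 x x)" if "x \<noteq> \<zero>\<^bsub>l2\<^esub>"
  proof -
    have "hnorm l2 x \<noteq> 0" "0 \<le> hnorm l2 x"
      using x that by (simp_all add: hnorm_l2 l2_norm_eq_0_iff)
    then show ?thesis by (simp add: hnorm_def less_le del: l2_simps)
  qed
  assume y: "y \<in> carrier l2"
  show "iprod l2 y x = cnj (iprod l2 x y)"
    by (simp add: infsum_cnj[symmetric] mult.commute del: infsum_cnj)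
  show "iprod l2 (c \<odot>\<^bsub>l2\<^esub> x) y = c * iprod l2 x y"
    by (simp add: mult.assoc infsum_cmult_right')
  assume "z \<in> carrier l2"
  with x y show "iprod l2 (x \<oplus>\<^bsub>l2\<^esub> y) z = iprod l2 x z + iprod l2 y z"
    by (simp add: algebra_simps infsum_add product_summable)
qed

section \<open>Standard basis vectors and infinite dimension\<close>

definition delta :: "'i \<Rightarrow> 'i \<Rightarrow> complex" where
  "delta i = (\<lambda>j. if j = i then 1 else 0)"

lemma has_sum_delta: "((\<lambda>j. (cmod (c * delta i j))\<^sup>2) has_sum (cmod c)\<^sup>2) UNIV"
  by (rule has_sum_finite_neutralI[of "{i}"]) (auto simp: delta_def)

lemma square_summable_delta: "square_summable (\<lambda>j. c * delta i j)"
  using has_sum_delta[of c i] unfolding square_summable_def summable_on_def by blast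

lemma l2_norm_delta: "l2_norm (\<lambda>j. c * delta i j) = cmod c"
  by (simp add: l2_norm_def infsumI[OF has_sum_delta])

lemma sum_fun_apply: "(\<Sum>v\<in>A. f v) i = (\<Sum>v\<in>A. f v i)"
  by (induction A rule: infinite_finite_induct) auto

text \<open>Bridge from the carrier-based sum to the type-class sum, so that results on
  \<open>vector_space\<close> apply to finite spanning sets.\<close>

lemma finsum_l2:
  assumes "finite B" "B \<subseteq> carrier l2"
  shows "(\<Oplus>\<^bsub>l2\<^esub>v\<in>B. c v \<odot>\<^bsub>l2\<^esub> v) = (\<Sum>v\<in>B. (\<lambda>i. c v * v i))"
  using assms
proof (induction B)
  case (insert v B)
  then show ?case
    by (subst l2.finsum_insert) (auto simp: square_summable_scale)
qed auto

text \<open>A finite spanning set bounds the size of every independent subset of its span, but the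
  infinitely many functions \<open>delta i\<close> are independent.\<close>

lemma infinite_dimensional_l2:
  fixes W :: "('i \<Rightarrow> complex) set"
  assumes "infinite (UNIV :: 'i set)" "W \<subseteq> carrier l2" "range delta \<subseteq> W"
  shows "\<not> finite_dimensional l2 W"
proof
  assume "finite_dimensional l2 W"
  then obtain B where B: "finite B" "B \<subseteq> W"
    and span: "\<And>w. w \<in> W \<Longrightarrow> \<exists>c. w = (\<Oplus>\<^bsub>l2\<^esub>v\<in>B. c v \<odot>\<^bsub>l2\<^esub> v)"
    unfolding finite_dimensional_def by blast
  \<comment> \<open>The ambient space is that of all functions, so spans and independence are
    available without a carrier.\<close>
  interpret V: vector_space "\<lambda>(c :: complex) (x :: 'i \<Rightarrow> complex) i. c * x i"
    by unfold_locales (auto simp: fun_eq_iff algebra_simps)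
  have "W \<subseteq> V.span B"
  proof
    fix w assume "w \<in> W"
    with span obtain c where "w = (\<Sum>v\<in>B. (\<lambda>i. c v * v i))"
      using finsum_l2[of B] B assms(2) by force
    then show "w \<in> V.span B"
      by (auto intro!: V.span_sum V.span_scale intro: V.span_base)
  qed
  moreover have "V.independent (range delta)"
    unfolding V.independent_explicit_module
  proof (intro allI impI)
    fix t :: "('i \<Rightarrow> complex) set" and u v
    assume t: "finite t" "t \<subseteq> range delta" "(\<Sum>v\<in>t. (\<lambda>i. u v * v i)) = 0" "v \<in> t"
    then obtain i where i: "v = delta i" by blast
    \<comment> \<open>Among the basis vectors only \<open>delta i\<close> is nonzero at
      \<open>i\<close>, so evaluation at \<open>i\<close> isolates the coefficient of
      \<open>v\<close>.\<close>
    have "u w * w i = (if w = v then u v else 0)" if w: "w \<in> t" for w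
    proof -
      obtain j where "w = delta j" using w t(2) by blast
      then show ?thesis using i by (cases "j = i") (auto simp: delta_def dest: fun_cong[of _ _ i])
    qed
    then have "(\<Sum>w\<in>t. u w * w i) = u v"
      using t by simp
    then show "u v = 0"
      using fun_cong[OF t(3), of i] by (simp add: sum_fun_apply)
  qed
  ultimately have "finite (range (delta :: 'i \<Rightarrow> _))"
    using V.independent_span_bound[OF B(1)] assms(3) by blast
  moreover have "inj (delta :: 'i \<Rightarrow> _)"
    by (rule injI) (metis delta_def one_neq_zero)
  ultimately show False using assms(1) by (simp add: finite_image_iff)
qed

section \<open>Affine signed permutations\<close>

text \<open>For \<open>signs e\<close> and bijective \<sigma> this is the action of a monomial
  matrix with nonzero entries 1 and -1.\<close>

definition signed_perm :: "('i \<Rightarrow> complex) \<Rightarrow> ('i \<Rightarrow> 'i) \<Rightarrow> ('i \<Rightarrow> complex) \<Rightarrow> 'i \<Rightarrow> complex" where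
  "signed_perm e \<sigma> x = (\<lambda>i. e i * x (\<sigma> i))"

definition signs :: "('i \<Rightarrow> complex) \<Rightarrow> bool" where
  "signs e \<longleftrightarrow> (\<forall>i. e i = 1 \<or> e i = -1)"

lemma signs_square: "signs e \<Longrightarrow> e i * e i = 1"
  unfolding signs_def by (metis mult_1 minus_mult_minus)

lemma signs_cnj: "signs e \<Longrightarrow> cnj (e i) = e i"
  unfolding signs_def by (metis complex_cnj_one complex_cnj_minus)

lemma signs_cmod: "signs e \<Longrightarrow> cmod (e i) = 1"
  unfolding signs_def by (metis norm_one norm_minus_cancel)

lemma signs_comp: "signs e \<Longrightarrow> signs f \<Longrightarrow> signs (signed_perm e \<sigma> f)"
  unfolding signs_def signed_perm_def by (metis mult_1 mult_minus1 minus_minus)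

lemma
  assumes "signs e" "bij \<sigma>"
  shows square_summable_signed_perm: "square_summable x \<Longrightarrow> square_summable (signed_perm e \<sigma> x)"
    and l2_norm_signed_perm: "l2_norm (signed_perm e \<sigma> x) = l2_norm x"
  using assms summable_on_reindex_bij_betw[of \<sigma> UNIV UNIV "\<lambda>i. (cmod (x i))\<^sup>2"]
    infsum_reindex_bij_betw[of \<sigma> UNIV UNIV "\<lambda>i. (cmod (x i))\<^sup>2"]
  by (auto simp: square_summable_def l2_norm_def signed_perm_def norm_mult signs_cmod)

text \<open>The signs are real with square 1 and cancel; reindexing the sum by \<sigma> removes the
  permutation.\<close>

lemma iprod_signed_perm:
  assumes "signs e" "bij \<sigma>"
  shows "iprod l2 (signed_perm e \<sigma> x) (signed_perm e \<sigma> y) = iprod l2 x y"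
proof -
  have "e i * x (\<sigma> i) * cnj (e i * y (\<sigma> i)) = e i * e i * (x (\<sigma> i) * cnj (y (\<sigma> i)))" for i
    using signs_cnj[OF assms(1), of i] by simp
  then have "iprod l2 (signed_perm e \<sigma> x) (signed_perm e \<sigma> y) =
      (\<Sum>\<^sub>\<infinity>i. x (\<sigma> i) * cnj (y (\<sigma> i)))"
    by (simp only: l2_simps signed_perm_def signs_square[OF assms(1)] mult_1)
  also have "\<dots> = iprod l2 x y"
    using infsum_reindex_bij_betw[of \<sigma> UNIV UNIV "\<lambda>i. x i * cnj (y i)"] assms(2) by simp
  finally show ?thesis .
qed

lemma signed_perm_add: "signed_perm e \<sigma> (x + y) = signed_perm e \<sigma> x + signed_perm e \<sigma> y"
  by (simp add: signed_perm_def fun_eq_iff distrib_left)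

text \<open>Moving the inner signs past \<sigma> evaluates \<open>f\<close> at
  \<open>\<sigma> i\<close>, so the sign vector of the composite is again given by
  \<open>signed_perm\<close>.\<close>

lemma signed_perm_comp:
  "signed_perm e \<sigma> (signed_perm f \<tau> x) = signed_perm (signed_perm e \<sigma> f) (\<tau> \<circ> \<sigma>) x"
  by (simp add: signed_perm_def mult.assoc)

lemma signed_perm_id: "signed_perm (\<lambda>_. 1) id x = x"
  by (simp add: signed_perm_def)

text \<open>Signs are their own inverses, so inverting only transports them along the inverse
  permutation. The equations are stated componentwise, in the form in which the group law produces
  them.\<close>

lemma signed_perm_inverse:
  assumes "signs e" "bij \<sigma>"
  defines "e' \<equiv> \<lambda>i. e (inv_into UNIV \<sigma> i)"
  shows "signs e'" "bij (inv_into UNIV \<sigma>)"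
    "signed_perm e' (inv_into UNIV \<sigma>) e = (\<lambda>_. 1)" "signed_perm e \<sigma> e' = (\<lambda>_. 1)"
    "\<sigma> \<circ> inv_into UNIV \<sigma> = id" "inv_into UNIV \<sigma> \<circ> \<sigma> = id"
proof -
  show "bij (inv_into UNIV \<sigma>)" using assms(2) by (rule bij_imp_bij_inv)
qed (use assms(1,2) in \<open>auto simp: e'_def signs_def signs_square signed_perm_def fun_eq_iff
  bij_is_surj surj_f_inv_f bij_is_inj\<close>)

text \<open>A triple \<open>(v, e, \<sigma>)\<close> stands for the affine isometry
  \<open>x \<mapsto> v + signed_perm e \<sigma> x\<close>; since \<open>signed_perm\<close> precomposes with
  \<open>\<sigma>\<close>, permutations multiply in reverse order.\<close>

definition affine_signed_group :: "(('i \<Rightarrow> complex) \<times> ('i \<Rightarrow> complex) \<times> ('i \<Rightarrow> 'i)) monoid" where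
  "affine_signed_group =
     \<lparr>carrier = {(v, e, \<sigma>). square_summable v \<and> signs e \<and> bij \<sigma>},
      monoid.mult = (\<lambda>(v, e, \<sigma>) (w, f, \<tau>). (v + signed_perm e \<sigma> w, signed_perm e \<sigma> f, \<tau> \<circ> \<sigma>)),
      one = (0, \<lambda>_. 1, id)\<rparr>"

lemma affine_signed_group_simps [simp]:
  "(v, e, \<sigma>) \<in> carrier affine_signed_group \<longleftrightarrow> square_summable v \<and> signs e \<and> bij \<sigma>"
  "(v, e, \<sigma>) \<otimes>\<^bsub>affine_signed_group\<^esub> (w, f, \<tau>) =
     (v + signed_perm e \<sigma> w, signed_perm e \<sigma> f, \<tau> \<circ> \<sigma>)"
  "\<one>\<^bsub>affine_signed_group\<^esub> = (0, \<lambda>_. 1, id)"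
  by (simp_all add: affine_signed_group_def)

lemma group_affine_signed_group: "group affine_signed_group"
proof (rule groupI)
  fix x y z :: "('a \<Rightarrow> complex) \<times> ('a \<Rightarrow> complex) \<times> ('a \<Rightarrow> 'a)"
  assume x: "x \<in> carrier affine_signed_group"
  obtain v e \<sigma> where xe: "x = (v, e, \<sigma>)" by (cases x)
  with x have xc: "square_summable v" "signs e" "bij \<sigma>" by auto
  note i = signed_perm_inverse[OF xc(2,3)]
  show "\<one>\<^bsub>affine_signed_group\<^esub> \<otimes>\<^bsub>affine_signed_group\<^esub> x = x"
    by (simp add: xe signed_perm_id)
  \<comment> \<open>With \<open>U\<close> the linear part, the inverse of
    \<open>x \<mapsto> v + U x\<close> has linear part \<open>U^-1\<close> and translation part
    \<open>-U^-1 v\<close>.\<close>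
  show "\<exists>y\<in>carrier affine_signed_group. y \<otimes>\<^bsub>affine_signed_group\<^esub> x = \<one>\<^bsub>affine_signed_group\<^esub>"
    using i xc unfolding xe
    by (intro bexI[of _ "(- signed_perm (\<lambda>i. e (inv_into UNIV \<sigma> i)) (inv_into UNIV \<sigma>) v, \<lambda>i. e (inv_into UNIV \<sigma> i), inv_into UNIV \<sigma>)"])
      (simp_all add: square_summable_uminus square_summable_signed_perm)
  assume y: "y \<in> carrier affine_signed_group"
  obtain w f \<tau> where ye: "y = (w, f, \<tau>)" by (cases y)
  show "x \<otimes>\<^bsub>affine_signed_group\<^esub> y \<in> carrier affine_signed_group"
    using x y unfolding xe ye
    by (auto simp: square_summable_add square_summable_signed_perm signs_comp intro: bij_comp)
  show "x \<otimes>\<^bsub>affine_signed_group\<^esub> y \<otimes>\<^bsub>affine_signed_group\<^esub> z =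
      x \<otimes>\<^bsub>affine_signed_group\<^esub> (y \<otimes>\<^bsub>affine_signed_group\<^esub> z)"
    unfolding xe ye
    by (cases z) (simp add: signed_perm_add signed_perm_comp add.assoc comp_assoc)
next
  show "\<one>\<^bsub>affine_signed_group\<^esub> \<in> carrier affine_signed_group"
    by (simp add: square_summable_zero signs_def)
qed

text \<open>The restriction is there because \<open>Bij\<close> contains only extensional
  functions.\<close>

definition linear_part where
  "linear_part = (\<lambda>(v, e, \<sigma>). restrict (signed_perm e \<sigma>) (carrier l2))"

lemma linear_part_hom: "linear_part \<in> hom affine_signed_group (unitary_group l2)"
proof (rule homI)
  fix x y :: "('a \<Rightarrow> complex) \<times> ('a \<Rightarrow> complex) \<times> ('a \<Rightarrow> 'a)"
  have *: "linear_part x \<in> unitary_operators l2" if x: "x \<in> carrier affine_signed_group"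
    for x :: "('a \<Rightarrow> complex) \<times> ('a \<Rightarrow> complex) \<times> ('a \<Rightarrow> 'a)"
  proof -
    obtain v e \<sigma> where xe: "x = (v, e, \<sigma>)" by (cases x)
    with x have xc: "signs e" "bij \<sigma>" by auto
    note i = signed_perm_inverse[OF xc]
    have "bij_betw (signed_perm e \<sigma>) (carrier l2) (carrier l2)"
      by (rule bij_betw_byWitness[where f' = "signed_perm (\<lambda>i. e (inv_into UNIV \<sigma> i)) (inv_into UNIV \<sigma>)"])
        (auto simp: signed_perm_comp i signed_perm_id square_summable_signed_perm xc)
    then have "linear_part x \<in> Bij (carrier l2)"
      by (simp add: xe linear_part_def Bij_def)
    then show ?thesis
      using iprod_signed_perm[OF xc]
      by (auto simp: unitary_operators_def xe linear_part_def square_summable_add square_summable_scale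
          signed_perm_add) (auto simp: signed_perm_def mult.left_commute)
  qed
  assume x: "x \<in> carrier affine_signed_group"
  then show "linear_part x \<in> carrier (unitary_group l2)"
    using * by (simp add: unitary_group_def)
  assume y: "y \<in> carrier affine_signed_group"
  have "linear_part x \<in> Bij (carrier l2)" "linear_part y \<in> Bij (carrier l2)"
    using *[OF x] *[OF y] by (auto simp: unitary_operators_def)
  moreover have "linear_part (x \<otimes>\<^bsub>affine_signed_group\<^esub> y) = compose (carrier l2) (linear_part x) (linear_part y)"
    using x y by (cases x; cases y)
      (auto simp: linear_part_def compose_def fun_eq_iff restrict_def square_summable_signed_perm signed_perm_comp)
  ultimately show "linear_part (x \<otimes>\<^bsub>affine_signed_group\<^esub> y) = linear_part x \<otimes>\<^bsub>unitary_group l2\<^esub> linear_part y"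
    by (simp add: unitary_group_def BijGroup_def)
qed

section \<open>Words in finitely generated groups\<close>

context group
begin

lemma foldr_closed: "set ws \<subseteq> carrier G \<Longrightarrow> foldr (\<otimes>) ws \<one> \<in> carrier G"
  by (induction ws) auto

lemma foldr_append:
  "set ws \<subseteq> carrier G \<Longrightarrow> set vs \<subseteq> carrier G \<Longrightarrow>
    foldr (\<otimes>) (ws @ vs) \<one> = foldr (\<otimes>) ws \<one> \<otimes> foldr (\<otimes>) vs \<one>"
proof (induction ws)
  case (Cons a ws)
  then show ?case using foldr_closed[of ws] foldr_closed[of vs] by (simp add: m_assoc)
next
  case Nil
  then show ?case using foldr_closed[of vs] by simp
qed

text \<open>Since \<open>S\<close> is closed under inverses, the inverse of a generator is again a
  single letter; products correspond to concatenation.\<close>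

lemma generate_imp_word:
  assumes "S \<subseteq> carrier G" "\<And>s. s \<in> S \<Longrightarrow> inv s \<in> S" "g \<in> generate G S"
  shows "\<exists>ws. set ws \<subseteq> S \<and> foldr (\<otimes>) ws \<one> = g"
  using assms(3)
proof induction
  case one
  show ?case by (rule exI[of _ "[]"]) simp
next
  case (incl h)
  then show ?case using assms(1) by (intro exI[of _ "[h]"]) auto
next
  case (inv h)
  then show ?case using assms(1,2) by (intro exI[of _ "[inv h]"]) auto
next
  case (eng h1 h2)
  then obtain ws vs where "set ws \<subseteq> S" "foldr (\<otimes>) ws \<one> = h1" "set vs \<subseteq> S" "foldr (\<otimes>) vs \<one> = h2"
    by blast
  then show ?case using assms(1) by (intro exI[of _ "ws @ vs"]) (auto simp: foldr_append simp del: List.foldr_append)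
qed

lemma countable_generate:
  assumes "S \<subseteq> carrier G" "\<And>s. s \<in> S \<Longrightarrow> inv s \<in> S" "countable S"
  shows "countable (generate G S)"
proof (rule countable_subset)
  show "generate G S \<subseteq> (\<lambda>ws. foldr (\<otimes>) ws \<one>) ` lists S"
    using generate_imp_word[OF assms(1,2)] by fastforce
  show "countable ((\<lambda>ws. foldr (\<otimes>) ws \<one>) ` lists S)"
    using assms(3) by (intro countable_image countable_lists)
qed

text \<open>Some word represents \<open>g\<close> because \<open>S\<close> generates, so the
  \<open>LEAST\<close> in \<open>word_length\<close> is attained.\<close>

lemma word_of_word_length:
  assumes "finite_symmetric_generating_set G S" "g \<in> carrier G"
  shows "\<exists>ws. set ws \<subseteq> S \<and> length ws = word_length G S g \<and> foldr (\<otimes>) ws \<one> = g"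
  unfolding word_length_def
proof (rule LeastI_ex)
  show "\<exists>n ws. set ws \<subseteq> S \<and> length ws = n \<and> foldr (\<otimes>) ws \<one> = g"
    using assms generate_imp_word[of S g] unfolding finite_symmetric_generating_set_def by blast
qed

lemma word_length_foldr_le: "set ws \<subseteq> S \<Longrightarrow> word_length G S (foldr (\<otimes>) ws \<one>) \<le> length ws"
  unfolding word_length_def by (rule Least_le) blast

text \<open>The subgroup generated by \<open>S\<close> is countable, so an injection into the
  naturals carries its structure over to a group on \<open>nat\<close>. The map \<phi> is the
  inverse of that injection, and \<open>T\<close> is the image of \<open>S\<close>.\<close>

lemma generated_subgroup_on_nat:
  assumes S: "finite S" "S \<subseteq> carrier G" "\<And>s. s \<in> S \<Longrightarrow> inv s \<in> S"
  shows "\<exists>(N :: nat monoid) T \<phi>. group N \<and> finite_symmetric_generating_set N T \<and>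
    \<phi> \<in> hom N G \<and> \<phi> ` T = S"
proof -
  define K where "K = generate G S"
  define G0 where "G0 = G\<lparr>carrier := K\<rparr>"
  define e where "e = to_nat_on K"
  define N where "N = image_group e G0"
  have K: "subgroup K G" "S \<subseteq> K"
    using generate_is_subgroup[OF S(2)] generate.incl[of _ S G] by (auto simp: K_def)
  have e: "inj_on e K"
    using countable_generate[OF S(2,3)] S(1) unfolding e_def K_def
    by (intro inj_on_to_nat_on) (auto intro: countable_finite)
  interpret G0: group G0
    unfolding G0_def using K(1) by (rule subgroup_imp_group)
  have N: "group N" and iso: "e \<in> iso G0 N"
    using G0.inj_imp_image_group_is_group[of e] inj_imp_image_group_iso[of e G0] e
    by (simp_all add: N_def G0_def)
  interpret e: group_hom G0 N e
    using N iso by (auto simp: group_hom_def group_hom_axioms_def iso_def)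
  have cN: "carrier N = e ` K"
    by (simp add: N_def image_group_carrier G0_def)
  \<comment> \<open>Isomorphisms map generated subgroups to generated subgroups, and generation
    inside \<open>K\<close> agrees with generation in \<open>G\<close>.\<close>
  have "generate N (e ` S) = carrier N"
    using e.generate_img[of S] K generate_consistent[OF K(2,1)]
    by (simp add: G0_def cN K_def)
  moreover have "inv\<^bsub>N\<^esub> (e s) = e (inv s)" if "s \<in> S" for s
    using e.hom_inv[of s] m_inv_consistent[OF K(1), of s] that K(2) by (auto simp: G0_def)
  ultimately have "finite_symmetric_generating_set N (e ` S)"
    using S K(2) by (auto simp: finite_symmetric_generating_set_def cN)
  moreover have "inv_into K e \<in> hom N G"
    using G0.iso_set_sym[OF iso] subgroup.subset[OF K(1)] by (fastforce simp: G0_def iso_def hom_def)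
  moreover have "inv_into K e ` (e ` S) = S"
    using e K(2) by (simp add: inv_into_image_cancel)
  ultimately show ?thesis using N by blast
qed

end

section \<open>Generators and invariant subspaces\<close>

text \<open>The two involutions generate an infinite dihedral group acting transitively on the natural
  numbers.\<close>

definition swap_even :: "nat \<Rightarrow> nat" where
  "swap_even n = (if even n then Suc n else n - 1)"

definition swap_odd :: "nat \<Rightarrow> nat" where
  "swap_odd n = (if n = 0 then 0 else if even n then n - 1 else Suc n)"

lemma swap_involution: "swap_even \<circ> swap_even = id" "swap_odd \<circ> swap_odd = id"
  by (auto simp: swap_even_def swap_odd_def fun_eq_iff)

lemma bij_swap: "bij swap_even" "bij swap_odd"
  using swap_involution o_bij by blast+

text \<open>On the half-line with edges from \<open>n\<close> to \<open>n + 1\<close>,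
  \<open>swap_even\<close> exchanges the ends of the edges with even \<open>n\<close>, and
  \<open>swap_odd\<close> those with odd \<open>n\<close>. Walking along edges gives
  transitivity.\<close>

lemma swap_step: "swap_even n = Suc n \<and> swap_even (Suc n) = n \<or> swap_odd n = Suc n \<and> swap_odd (Suc n) = n"
  by (auto simp: swap_even_def swap_odd_def)

definition flip0 :: "nat \<Rightarrow> complex" where
  "flip0 n = (if n = 0 then -1 else 1)"

text \<open>The complex parameter puts the generator \<open>translation 1\<close>, its inverse and
  its powers into one family closed under products.\<close>

definition translation :: "complex \<Rightarrow> (nat \<Rightarrow> complex) \<times> (nat \<Rightarrow> complex) \<times> (nat \<Rightarrow> nat)" where
  "translation c = (\<lambda>j. c * delta 0 j, \<lambda>_. 1, id)"

lemma translation_add: "translation c \<otimes>\<^bsub>affine_signed_group\<^esub> translation d = translation (c + d)"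
  by (simp add: translation_def signed_perm_def fun_eq_iff distrib_right)

lemma translation_0: "translation 0 = \<one>\<^bsub>affine_signed_group\<^esub>"
  by (simp add: translation_def fun_eq_iff)

definition generators :: "((nat \<Rightarrow> complex) \<times> (nat \<Rightarrow> complex) \<times> (nat \<Rightarrow> nat)) set" where
  "generators = {translation 1, translation (-1), (0, flip0, id), (0, \<lambda>_. 1, swap_even), (0, \<lambda>_. 1, swap_odd)}"

lemma signs_1: "signs (\<lambda>_. 1)" and signs_flip0: "signs flip0"
  by (auto simp: signs_def flip0_def)

lemma generators_carrier: "generators \<subseteq> carrier affine_signed_group"
  using square_summable_delta[of 1] square_summable_delta[of "-1"]
  by (auto simp: generators_def translation_def signs_1 signs_flip0 bij_swap square_summable_zero)

lemma generators_inverse: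
  assumes "s \<in> generators"
  shows "inv\<^bsub>affine_signed_group\<^esub> s \<in> generators"
proof -
  interpret A: group "affine_signed_group :: ((nat \<Rightarrow> complex) \<times> (nat \<Rightarrow> complex) \<times> (nat \<Rightarrow> nat)) monoid"
    by (rule group_affine_signed_group)
  have "translation (-1) \<otimes>\<^bsub>affine_signed_group\<^esub> translation 1 = \<one>\<^bsub>affine_signed_group\<^esub>"
    "translation 1 \<otimes>\<^bsub>affine_signed_group\<^esub> translation (-1) = \<one>\<^bsub>affine_signed_group\<^esub>"
    by (simp_all only: translation_add translation_0[symmetric]) simp_all
  \<comment> \<open>The other three generators are involutions. The square has sign
    \<open>e i * e (\<sigma> i)\<close> at \<open>i\<close>, hence the condition that
    \<open>e\<close> be invariant under \<sigma>.\<close>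
  moreover have "(0, e, \<sigma>) \<otimes>\<^bsub>affine_signed_group\<^esub> (0, e, \<sigma>) = \<one>\<^bsub>affine_signed_group\<^esub>"
    if "signs e" "\<sigma> \<circ> \<sigma> = id" "\<And>i. e (\<sigma> i) = e i" for e :: "nat \<Rightarrow> complex" and \<sigma>
    using that by (simp add: signed_perm_def fun_eq_iff signs_square)
  ultimately have "\<exists>t\<in>generators. t \<otimes>\<^bsub>affine_signed_group\<^esub> s = \<one>\<^bsub>affine_signed_group\<^esub>"
    using assms signs_1 signs_flip0 swap_involution unfolding generators_def by fastforce
  then obtain t where "t \<in> generators" "t \<otimes>\<^bsub>affine_signed_group\<^esub> s = \<one>\<^bsub>affine_signed_group\<^esub>"
    by blast
  then show ?thesis
    using A.inv_equality[of t s] generators_carrier assms by auto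
qed

section \<open>Norms of translation parts\<close>

lemma l2_norm_translation: "l2_norm (fst (translation c)) = cmod c"
  by (simp add: translation_def l2_norm_delta)

lemma generators_translation_norm:
  assumes "s \<in> generators"
  shows "l2_norm (fst s) \<le> 1"
proof -
  have "l2_norm (0 :: nat \<Rightarrow> complex) = 0" by (simp add: l2_norm_def)
  then show ?thesis
    using assms unfolding generators_def by (elim insertE emptyE) (simp_all add: l2_norm_translation)
qed

text \<open>The linear part of \<open>x\<close> is isometric, so this is the triangle inequality; it
  drives the bound of the cocycle by word length.\<close>

lemma translation_norm_mult:
  assumes "x \<in> carrier affine_signed_group" "y \<in> carrier affine_signed_group"
  shows "l2_norm (fst (x \<otimes>\<^bsub>affine_signed_group\<^esub> y)) \<le> l2_norm (fst x) + l2_norm (fst y)"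
proof -
  obtain v e \<sigma> w f \<tau> where "x = (v, e, \<sigma>)" "y = (w, f, \<tau>)" by (metis surj_pair)
  then show ?thesis
    using assms l2_norm_triangle[of v "signed_perm e \<sigma> w"]
    by (simp add: square_summable_signed_perm l2_norm_signed_perm)
qed

section \<open>Invariant subspaces of the linear action\<close>

lemma linear_part_apply:
  "square_summable x \<Longrightarrow> linear_part (v, e, \<sigma>) x = signed_perm e \<sigma> x"
  by (simp add: linear_part_def)

lemma invariant_subspace_contains_deltas:
  assumes W: "submodule W complex_ring l2" "W \<noteq> {0}"
    and inv: "\<And>s w. s \<in> generators \<Longrightarrow> w \<in> W \<Longrightarrow> linear_part s w \<in> W"
  shows "range delta \<subseteq> W"
proof -
  interpret W: submodule W complex_ring l2 by (rule W(1))
  have sq: "square_summable w" if "w \<in> W" for w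
    using W.subset that by auto
  have scale: "(\<lambda>i. c * w i) \<in> W" if "w \<in> W" for c w
    using W.smult_closed[of c w] that by (simp add: complex_ring_def)
  \<comment> \<open>\<open>submodule\<close> builds on \<open>subgroup\<close> of the additive
    monoid, so \<open>m_closed\<close> is closure under addition, and \<open>one_closed\<close>
    below says that \<open>W\<close> contains zero.\<close>
  have add: "v + w \<in> W" if "v \<in> W" "w \<in> W" for v w
    using W.m_closed[OF that] by simp
  have swaps: "(\<lambda>i. w (swap_even i)) \<in> W" "(\<lambda>i. w (swap_odd i)) \<in> W" and flip: "(\<lambda>i. flip0 i * w i) \<in> W"
    if "w \<in> W" for w
    using inv[OF _ that, of "(0, \<lambda>_. 1, swap_even)"] inv[OF _ that, of "(0, \<lambda>_. 1, swap_odd)"]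
      inv[OF _ that, of "(0, flip0, id)"] sq[OF that]
    by (simp_all add: generators_def linear_part_apply signed_perm_def)
  have "0 \<in> W" using W.one_closed by simp
  with W(2) obtain w i where w: "w \<in> W" "w i \<noteq> 0"
    by (metis (no_types, lifting) empty_iff ext insertI1 subsetI subset_singletonD zero_fun_apply)
  \<comment> \<open>The swap along the edge from \<open>i\<close> to \<open>i + 1\<close> brings the
    nonzero value one place closer to 0.\<close>
  from w have "\<exists>w\<in>W. w 0 \<noteq> 0"
  proof (induction i arbitrary: w)
    case (Suc i)
    show ?case
      using swap_step[of i] swaps[OF Suc.prems(1)] Suc.IH Suc.prems(2) by metis
  qed blast
  then obtain w where w: "w \<in> W" "w 0 \<noteq> 0" by blast
  txt \<open>\<open>w\<close> minus its sign flip at 0 is \<open>2 * w 0 * delta 0\<close>.\<close>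
  have "(\<lambda>i. 1 / (2 * w 0) * (w + (\<lambda>i. -1 * (flip0 i * w i))) i) \<in> W"
    by (intro scale add flip w)
  moreover have "(\<lambda>i. 1 / (2 * w 0) * (w + (\<lambda>i. -1 * (flip0 i * w i))) i) = delta 0"
    using w(2) by (auto simp: delta_def flip0_def fun_eq_iff)
  ultimately have "delta 0 \<in> W" by simp
  then have "delta n \<in> W" for n
  proof (induction n)
    case (Suc n)
    \<comment> \<open>Precomposition moves the support to the preimage of \<open>n\<close>, which
      for an involution is \<open>\<sigma> n\<close>; \<open>swap_step\<close> provides one with
      \<open>\<sigma> n = n + 1\<close>.\<close>
    have "(\<lambda>i. delta n (\<sigma> i)) = delta (\<sigma> n)" if "\<sigma> \<circ> \<sigma> = id" for \<sigma> :: "nat \<Rightarrow> nat"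
      using that by (auto simp: delta_def fun_eq_iff)
    then show ?case
      using swap_step[of n] swaps[OF Suc.IH[OF Suc.prems]] swap_involution by metis
  qed
  then show ?thesis by blast
qed

section \<open>The representation, its cocycle and the growth of the cocycle\<close>

theorem proposition3:
  shows "\<exists>(G :: nat monoid) (S :: nat set) (H :: (nat \<Rightarrow> complex) hilbert)
            (\<pi> :: nat \<Rightarrow> (nat \<Rightarrow> complex) \<Rightarrow> (nat \<Rightarrow> complex)) (b :: nat \<Rightarrow> (nat \<Rightarrow> complex)).
           group G \<and> finite_symmetric_generating_set G S \<and>
           complex_hilbert_space H \<and> unitary_representation G H \<pi> \<and> weakly_mixing G H \<pi> \<and>
           cocycle G H \<pi> b \<and>
           (\<lambda>N. SUP g\<in>{g \<in> carrier G. N \<le> word_length G S g}.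
                  ereal (hnorm H (b g) / real (word_length G S g)))
             \<longlonglongrightarrow> 1"
proof -
  let ?A = "affine_signed_group :: ((nat \<Rightarrow> complex) \<times> (nat \<Rightarrow> complex) \<times> (nat \<Rightarrow> nat)) monoid"
  let ?H = "l2 :: (nat \<Rightarrow> complex) hilbert"
  interpret A: group ?A by (rule group_affine_signed_group)
  obtain G :: "nat monoid" and S \<phi> where G: "group G" and S: "finite_symmetric_generating_set G S"
    and \<phi>: "\<phi> \<in> hom G ?A" "\<phi> ` S = generators"
    using A.generated_subgroup_on_nat[OF _ generators_carrier generators_inverse]
    by (auto simp: generators_def)
  interpret \<phi>: group_hom G ?A \<phi>
    using G \<phi>(1) A.group_axioms by (simp add: group_hom_def group_hom_axioms_def)
  have SG: "S \<subseteq> carrier G" using S by (simp add: finite_symmetric_generating_set_def)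
  define \<pi> where "\<pi> = (\<lambda>g. linear_part (\<phi> g))"
  define b where "b = (\<lambda>g. fst (\<phi> g))"
  have rep: "unitary_representation G ?H \<pi>"
    using G complex_hilbert_space_l2 hom_compose[OF \<phi>(1) linear_part_hom]
    by (simp add: unitary_representation_def \<pi>_def o_def)
  have b_sq: "square_summable (b g)" if "g \<in> carrier G" for g
    using \<phi>.hom_closed[OF that] by (cases "\<phi> g") (auto simp: b_def)
  \<comment> \<open>The cocycle identity is the first component of the product in
    \<open>affine_signed_group\<close>.\<close>
  have "b (g \<otimes>\<^bsub>G\<^esub> h) = b g \<oplus>\<^bsub>?H\<^esub> \<pi> g (b h)" if "g \<in> carrier G" "h \<in> carrier G" for g h
    using \<phi>.hom_mult[OF that] b_sq[OF that(2)]
    by (cases "\<phi> g"; cases "\<phi> h") (simp add: b_def \<pi>_def linear_part_apply)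
  then have coc: "cocycle G ?H \<pi> b"
    using b_sq by (auto simp: cocycle_def)
  have mixing: "weakly_mixing G ?H \<pi>"
    unfolding weakly_mixing_def
  proof (intro notI, elim exE conjE)
    fix W
    assume W: "subrepresentation G ?H \<pi> W" "finite_dimensional ?H W" "W \<noteq> {\<zero>\<^bsub>?H\<^esub>}"
    then have sub: "submodule W complex_ring ?H" by (simp add: subrepresentation_def)
    have "linear_part s w \<in> W" if sw: "s \<in> generators" "w \<in> W" for s w
    proof -
      obtain t where "t \<in> carrier G" "s = \<phi> t" using sw(1) \<phi>(2) SG by blast
      then show ?thesis
        using sw(2) W(1) by (simp add: subrepresentation_def \<pi>_def)
    qed
    then have "range delta \<subseteq> W"
      using invariant_subspace_contains_deltas[OF sub] W(3) by simp
    moreover have "W \<subseteq> carrier ?H"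
      using subgroup.subset[OF submodule.axioms(1)[OF sub]] by simp
    ultimately show False
      using infinite_dimensional_l2[of W] W(2) by simp
  qed
  have upper: "l2_norm (b g) \<le> word_length G S g" if g: "g \<in> carrier G" for g
  proof -
    \<comment> \<open>The induction runs over arbitrary words; a shortest word for \<open>g\<close>
      then gives the claim.\<close>
    have "l2_norm (b (foldr (\<otimes>\<^bsub>G\<^esub>) ws \<one>\<^bsub>G\<^esub>)) \<le> length ws" if "set ws \<subseteq> S" for ws
      using that
    proof (induction ws)
      case Nil
      then show ?case by (simp add: b_def l2_norm_def)
    next
      case (Cons s ws)
      let ?w = "foldr (\<otimes>\<^bsub>G\<^esub>) ws \<one>\<^bsub>G\<^esub>"
      have s: "s \<in> carrier G" "\<phi> s \<in> generators" and w: "?w \<in> carrier G"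
        using Cons.prems SG \<phi>(2) by (auto intro!: \<phi>.G.foldr_closed)
      have "l2_norm (b (s \<otimes>\<^bsub>G\<^esub> ?w)) \<le> l2_norm (b s) + l2_norm (b ?w)"
        using translation_norm_mult[of "\<phi> s" "\<phi> ?w"] s w by (simp add: b_def)
      also have "l2_norm (b s) \<le> 1"
        using generators_translation_norm[OF s(2)] by (simp add: b_def)
      finally show ?case using Cons by simp
    qed
    then show ?thesis
      using \<phi>.G.word_of_word_length[OF S g] by metis
  qed
  have lower: "\<exists>g\<in>carrier G. word_length G S g = n \<and> l2_norm (b g) = n" for n
  proof -
    have "translation 1 \<in> \<phi> ` S" unfolding \<phi>(2) generators_def by blast
    then obtain a where a: "a \<in> S" "\<phi> a = translation 1" by (metis imageE)
    define g where "g = foldr (\<otimes>\<^bsub>G\<^esub>) (replicate n a) \<one>\<^bsub>G\<^esub>"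
    have power: "foldr (\<otimes>\<^bsub>G\<^esub>) (replicate m a) \<one>\<^bsub>G\<^esub> \<in> carrier G" for m
      using a(1) SG by (intro \<phi>.G.foldr_closed) auto
    then have g: "g \<in> carrier G" by (simp only: g_def)
    have "\<phi> g = translation (of_nat n)"
      unfolding g_def
    proof (induction n)
      case 0
      then show ?case by (simp add: translation_0)
    next
      case (Suc n)
      have "a \<in> carrier G" using a(1) SG by blast
      with Suc power[of n] show ?case
        by (simp add: a(2) translation_add)
    qed
    then have "l2_norm (b g) = n"
      by (simp add: b_def l2_norm_translation)
    \<comment> \<open>The word \<open>replicate n a\<close> bounds the length above by
      \<open>n\<close>, and \<open>upper\<close> bounds it below by the norm of \<open>b g\<close>,
      which is \<open>n\<close>.\<close>
    moreover have "word_length G S g \<le> n"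
      using \<phi>.G.word_length_foldr_le[of "replicate n a" S] a(1) by (simp add: g_def set_replicate_conv_if)
    ultimately show ?thesis
      using upper[OF g] g by (intro bexI[of _ g]) auto
  qed
  \<comment> \<open>The tail suprema are constantly 1 from \<open>N = 1\<close> on. The condition
    \<open>1 \<le> N\<close> keeps the denominators positive, so the element from
    \<open>lower\<close> has quotient \<open>N / N = 1\<close>.\<close>
  have "(SUP g\<in>{g \<in> carrier G. N \<le> word_length G S g}.
      ereal (hnorm ?H (b g) / real (word_length G S g))) = 1" if "1 \<le> N" for N
  proof (rule antisym)
    show "(SUP g\<in>{g \<in> carrier G. N \<le> word_length G S g}.
        ereal (hnorm ?H (b g) / real (word_length G S g))) \<le> 1"
      using that upper by (intro SUP_least) (auto simp: hnorm_l2 b_sq one_ereal_def divide_le_eq_1)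
    obtain g where g: "g \<in> carrier G" "word_length G S g = N" "l2_norm (b g) = N"
      using lower by blast
    have "(1 :: ereal) = ereal (hnorm ?H (b g) / real (word_length G S g))"
      using g that by (simp add: hnorm_l2 b_sq)
    also have "\<dots> \<le> (SUP g\<in>{g \<in> carrier G. N \<le> word_length G S g}.
        ereal (hnorm ?H (b g) / real (word_length G S g)))"
      using g by (intro SUP_upper) auto
    finally show "1 \<le> (SUP g\<in>{g \<in> carrier G. N \<le> word_length G S g}.
        ereal (hnorm ?H (b g) / real (word_length G S g)))" .
  qed
  then have "(\<lambda>N. SUP g\<in>{g \<in> carrier G. N \<le> word_length G S g}.
      ereal (hnorm ?H (b g) / real (word_length G S g))) \<longlonglongrightarrow> 1"
    by (intro tendsto_eventually) (auto simp: eventually_sequentially)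
  with G S complex_hilbert_space_l2 rep mixing coc show ?thesis by blast
qed

end
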